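(* Let $\Phi:\mathcal{M}_2(\mathbb{C})\to\mathcal{M}_2(\mathbb{C})$ be a doubly stochastic map. Then $\Phi$ is self-dual if and only if it admits a Kraus decomposition of the form \[\Phi(A)=\sum_{i=1}^m p_iR_iAR_i\quad\text{for all }A\in\mathcal{M}_2(\mathbb{C}),\] where $\{R_i\}_{i=1}^m$ is a (finite) collection of $2\times 2$ matrices that are both unitary and Hermitian, and $\sum_{i=1}^m p_i=1$ with $p_i>0$ for all $i$.
   Context: $\mathcal{M}_n(\mathbb{C})$ is the space of $n\times n$ complex matrices, with inner product $\langle A,B\rangle=\mathrm{Tr}(AB^* )$. A linear map $\Phi:\mathcal{M}_n(\mathbb{C})\to\mathcal{M}_n(\mathbb{C})$ is completely positive if $\Phi\otimes I_k$ maps positive semidefinite matrices to positive semidefinite matrices for all $k\in\mathbb{N}$ (equivalently, $\Phi(A)=\sum_{i=1}^r V_iAV_i^*$ for some $V_i\in\mathcal{M}_n(\mathbb{C})$). A doubly stochastic map is a completely positive linear map that is unital ($\Phi(I_n)=I_n$) and trace-preserving ($\mathrm{Tr}(\Phi(A))=\mathrm{Tr}(A)$ for all $A$). The dual of $\Phi$ is the linear map $\Phi^*$ with $\langle A,\Phi(B)\rangle=\langle\Phi^*(A),B\rangle$ for all $A,B$; $\Phi$ is self-dual if $\Phi=\Phi^*$. *)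

theory Defs
  imports "HOL-Analysis.Analysis"
begin

definition conj_transpose :: "complex^'n^'m \<Rightarrow> complex^'m^'n" where
  "conj_transpose A = map_matrix cnj (transpose A)"

definition hermitian :: "complex^'n^'n \<Rightarrow> bool" where
  "hermitian A \<longleftrightarrow> conj_transpose A = A"

definition unitary :: "complex^'n^'n \<Rightarrow> bool" where
  "unitary U \<longleftrightarrow> U ** conj_transpose U = mat 1 \<and> conj_transpose U ** U = mat 1"

definition hs_inner :: "complex^'n^'n \<Rightarrow> complex^'n^'n \<Rightarrow> complex" where
  "hs_inner A B = trace (A ** conj_transpose B)"

text \<open>The library's \<open>linear\<close> on matrices is only linear over the reals; the maps here are
  linear over the complex numbers.\<close>

definition cscale :: "complex \<Rightarrow> complex^'n^'n \<Rightarrow> complex^'n^'n" where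
  "cscale c A = map_matrix ((*) c) A"

lemma vector_space_cscale: "vector_space cscale"
  by unfold_locales (simp_all add: cscale_def vec_eq_iff algebra_simps)

abbreviation clinear :: "(complex^'n^'n \<Rightarrow> complex^'n^'n) \<Rightarrow> bool" where
  "clinear \<equiv> Vector_Spaces.linear cscale cscale"

lemma clinear_iff:
  "clinear \<Phi> \<longleftrightarrow>
    (\<forall>A B. \<Phi> (A + B) = \<Phi> A + \<Phi> B) \<and> (\<forall>c A. \<Phi> (cscale c A) = cscale c (\<Phi> A))"
  by (simp add: Vector_Spaces.linear_iff vector_space_cscale)

text \<open>A square matrix with rows and columns indexed by a finite set \<open>I\<close> is a function
  of two indices; its values outside \<open>I\<close> are ignored. Being nonnegative includes being real, so
  no separate Hermitian condition is needed.\<close>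

definition psd_on :: "'i set \<Rightarrow> ('i \<Rightarrow> 'i \<Rightarrow> complex) \<Rightarrow> bool" where
  "psd_on I M \<longleftrightarrow> (\<forall>x. (\<Sum>i\<in>I. \<Sum>j\<in>I. cnj (x i) * M i j * x j) \<in> \<real>\<^sub>\<ge>\<^sub>0)"

text \<open>Elements of the tensor product of the \<open>n \<times> n\<close> and the \<open>k \<times> k\<close> matrices are matrices
  indexed by \<open>UNIV \<times> {..<k}\<close>, where \<open>(r, a)\<close> stands for the basis vector
  \<open>e\<^sub>r \<otimes> e\<^sub>a\<close>. Below, \<open>ampliation \<Phi>\<close> is \<open>\<Phi> \<otimes> I\<^sub>k\<close>: it applies
  \<open>\<Phi>\<close> to each of the \<open>k\<^sup>2\<close> blocks \<open>(M (r, a) (s, b))\<^sub>r\<^sub>s\<close>. Since it acts blockwise, the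
  formula does not depend on \<open>k\<close>.\<close>

definition ampliation ::
    "(complex^'n^'n \<Rightarrow> complex^'n^'n) \<Rightarrow>
     ('n \<times> nat \<Rightarrow> 'n \<times> nat \<Rightarrow> complex) \<Rightarrow> 'n \<times> nat \<Rightarrow> 'n \<times> nat \<Rightarrow> complex" where
  "ampliation \<Phi> M = (\<lambda>(i, a) (j, b). \<Phi> (\<chi> r s. M (r, a) (s, b)) $ i $ j)"

definition completely_positive :: "(complex^'n^'n \<Rightarrow> complex^'n^'n) \<Rightarrow> bool" where
  "completely_positive \<Phi> \<longleftrightarrow> clinear \<Phi> \<and>
     (\<forall>k::nat. \<forall>M. psd_on (UNIV \<times> {..<k}) M \<longrightarrow> psd_on (UNIV \<times> {..<k}) (ampliation \<Phi> M))"

definition doubly_stochastic :: "(complex^'n^'n \<Rightarrow> complex^'n^'n) \<Rightarrow> bool" where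
  "doubly_stochastic \<Phi> \<longleftrightarrow> completely_positive \<Phi> \<and> \<Phi> (mat 1) = mat 1 \<and>
     (\<forall>A. trace (\<Phi> A) = trace A)"

definition is_dual_map ::
    "(complex^'n^'n \<Rightarrow> complex^'n^'n) \<Rightarrow> (complex^'n^'n \<Rightarrow> complex^'n^'n) \<Rightarrow> bool" where
  "is_dual_map \<Phi> \<Psi> \<longleftrightarrow> clinear \<Psi> \<and> (\<forall>A B. hs_inner A (\<Phi> B) = hs_inner (\<Psi> A) B)"

lemma hs_inner_sum: "hs_inner A B = (\<Sum>i\<in>UNIV. \<Sum>j\<in>UNIV. A $ i $ j * cnj (B $ i $ j))"
  by (simp add: hs_inner_def trace_def matrix_matrix_mult_def conj_transpose_def transpose_def)

lemma hs_inner_add_left: "hs_inner (A + B) C = hs_inner A C + hs_inner B C"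
  by (simp add: hs_inner_sum algebra_simps sum.distrib)

lemma hs_inner_cscale_left: "hs_inner (cscale c A) B = c * hs_inner A B"
  by (simp add: hs_inner_sum cscale_def sum_distrib_left algebra_simps)

lemma hs_inner_add_right: "hs_inner A (B + C) = hs_inner A B + hs_inner A C"
  by (simp add: hs_inner_sum algebra_simps sum.distrib)

lemma hs_inner_cscale_right: "hs_inner A (cscale c B) = cnj c * hs_inner A B"
  by (simp add: hs_inner_sum cscale_def sum_distrib_left algebra_simps)

lemma hs_inner_sum_right: "hs_inner A (\<Sum>x\<in>X. f x) = (\<Sum>x\<in>X. hs_inner A (f x))"
proof (cases "finite X")
  case True
  then show ?thesis
    by (induction X) (auto simp: hs_inner_add_right, simp add: hs_inner_sum)
qed (simp add: hs_inner_sum)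

definition unit_matrix :: "'n \<Rightarrow> 'n \<Rightarrow> complex^'n^'n" where
  "unit_matrix r s = (\<chi> i j. if i = r \<and> j = s then 1 else 0)"

lemma hs_inner_unit_matrix: "hs_inner A (unit_matrix r s) = A $ r $ s"
proof -
  have "hs_inner A (unit_matrix r s) =
      (\<Sum>i\<in>UNIV. \<Sum>j\<in>UNIV. if j = s then (if i = r then A $ i $ j else 0) else 0)"
    unfolding hs_inner_sum unit_matrix_def by (intro sum.cong) auto
  then show ?thesis by simp
qed

lemma matrix_expansion:
  "(B :: complex^'n^'n) = (\<Sum>r\<in>UNIV. \<Sum>s\<in>UNIV. cscale (B $ r $ s) (unit_matrix r s))"
proof -
  have "(\<Sum>r\<in>UNIV. \<Sum>s\<in>UNIV. cscale (B $ r $ s) (unit_matrix r s)) $ i $ j = B $ i $ j" for i j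
  proof -
    have "(\<Sum>r\<in>UNIV. \<Sum>s\<in>UNIV. cscale (B $ r $ s) (unit_matrix r s)) $ i $ j =
        (\<Sum>r\<in>UNIV. \<Sum>s\<in>UNIV. if s = j then (if r = i then B $ r $ s else 0) else 0)"
      unfolding sum_component cscale_def unit_matrix_def by (intro sum.cong) auto
    then show ?thesis by simp
  qed
  then show ?thesis by (simp add: vec_eq_iff)
qed

lemma clinear_expansion:
  assumes "clinear \<Phi>"
  shows "\<Phi> B = (\<Sum>r\<in>UNIV. \<Sum>s\<in>UNIV. cscale (B $ r $ s) (\<Phi> (unit_matrix r s)))"
proof -
  interpret Vector_Spaces.linear cscale cscale \<Phi> by (fact assms)
  show ?thesis by (subst matrix_expansion[of B]) (simp add: sum scale)
qed

lemma is_dual_map_unique: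
  assumes "is_dual_map \<Phi> \<Psi>" "is_dual_map \<Phi> \<Psi>'"
  shows "\<Psi> = \<Psi>'"
proof
  fix A
  have "\<Psi> A $ r $ s = \<Psi>' A $ r $ s" for r s
    using assms unfolding is_dual_map_def by (metis hs_inner_unit_matrix)
  then show "\<Psi> A = \<Psi>' A" by (simp add: vec_eq_iff)
qed

lemma is_dual_map_exists:
  assumes "clinear \<Phi>"
  shows "\<exists>\<Psi>. is_dual_map \<Phi> \<Psi>"
proof
  let ?\<Psi> = "\<lambda>A. \<chi> r s. hs_inner A (\<Phi> (unit_matrix r s))"
  have "clinear ?\<Psi>"
    by (simp add: clinear_iff vec_eq_iff hs_inner_add_left hs_inner_cscale_left)
      (simp add: cscale_def)
  moreover have "hs_inner A (\<Phi> B) = hs_inner (?\<Psi> A) B" for A B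
    by (subst clinear_expansion[OF assms])
      (simp add: hs_inner_sum_right hs_inner_cscale_right hs_inner_sum[of "?\<Psi> A"] mult.commute)
  ultimately show "is_dual_map \<Phi> ?\<Psi>" unfolding is_dual_map_def by blast
qed

definition dual_map :: "(complex^'n^'n \<Rightarrow> complex^'n^'n) \<Rightarrow> complex^'n^'n \<Rightarrow> complex^'n^'n" where
  "dual_map \<Phi> = (THE \<Psi>. is_dual_map \<Phi> \<Psi>)"

lemma is_dual_map_dual_map:
  assumes "clinear \<Phi>"
  shows "is_dual_map \<Phi> (dual_map \<Phi>)"
proof -
  obtain \<Psi> where \<Psi>: "is_dual_map \<Phi> \<Psi>" using is_dual_map_exists[OF assms] by blast
  show ?thesis unfolding dual_map_def
    by (rule theI[of "is_dual_map \<Phi>", OF \<Psi>]) (rule is_dual_map_unique[OF _ \<Psi>])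
qed

definition self_dual :: "(complex^'n^'n \<Rightarrow> complex^'n^'n) \<Rightarrow> bool" where
  "self_dual \<Phi> \<longleftrightarrow> \<Phi> = dual_map \<Phi>"

end

theory Submission
  imports Defs
begin

text \<open>
  Write a map as \<open>\<Phi> A = (\<Sum>j k. \<chi> j k * \<sigma>\<^sub>j A \<sigma>\<^sub>k)\<close> in the basis of the identity
  \<open>\<sigma>\<^sub>0\<close> and the three Pauli matrices. Complete positivity says that the \<open>4 \<times> 4\<close> matrix \<open>\<chi>\<close>
  is positive semidefinite, since \<open>4 * \<chi> j k\<close> is the Choi form of \<open>\<Phi>\<close> evaluated at
  \<open>\<sigma>\<^sub>j\<close> and \<open>\<sigma>\<^sub>k\<close>. The Pauli matrices being Hermitian, the dual map has the complex conjugate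
  coefficients, so self-duality makes \<open>\<chi>\<close> real and symmetric. The antisymmetric part of the
  products \<open>\<sigma>\<^sub>j \<sigma>\<^sub>k\<close> then drops out of \<open>\<Phi> 1\<close>, and unitality forces
  \<open>\<chi> 0 k = 0\<close> for \<open>k \<noteq> 0\<close>. Thus \<open>\<chi>\<close> is a nonnegative number \<open>p0\<close> next to a real positive
  semidefinite \<open>3 \<times> 3\<close> block \<open>X\<close>.

  Any decomposition \<open>X = (\<Sum>k. v\<^sub>k v\<^sub>k\<^sup>T)\<close> into real rank-one matrices now does the job, for it gives
  \<open>\<Phi> A = p0 A + (\<Sum>k. (v\<^sub>k \<cdot> \<sigma>) A (v\<^sub>k \<cdot> \<sigma>))\<close>, where the Hermitian matrix \<open>v \<cdot> \<sigma>\<close> squares to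
  \<open>\<bar>v\<bar>\<^sup>2\<close> and hence is \<open>\<bar>v\<bar>\<close> times a Hermitian unitary. The vectors need not be orthogonal, so
  completing squares (\<open>real_psd_decomposition\<close>) replaces the spectral theorem. The weights
  \<open>p0\<close> and \<open>\<bar>v\<^sub>k\<bar>\<^sup>2\<close> sum to one because \<open>\<Phi>\<close> is unital.

  Conversely, conjugation by a Hermitian matrix is its own dual
  (\<open>hs_inner_hermitian_conjugation\<close>), and so is every real combination of such maps.
\<close>

section \<open>Positive semidefinite matrices\<close>

text \<open>Polarization: the quadratic form is real at \<open>e\<^sub>i + c e\<^sub>j\<close>. With \<open>c = 1\<close> and \<open>c = \<i>\<close> this
  controls the imaginary and the real part of the off-diagonal pair.\<close>

lemma psd_on_hermitian:
  assumes "finite I" "psd_on I M" "i \<in> I" "j \<in> I"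
  shows "M j i = cnj (M i j)"
proof -
  define Q where "Q x = (\<Sum>k\<in>I. \<Sum>l\<in>I. cnj (x k) * M k l * x l)" for x
  have real: "Im (Q x) = 0" for x
    using assms(2) unfolding psd_on_def Q_def by (auto simp: complex_nonneg_Reals_iff)
  define x where "x c k = (if k = i then 1 else 0) + (if k = j then c else 0)" for c :: complex and k
  have row: "(\<Sum>l\<in>I. f l * x c l) = f i + c * f j" for f c
    using assms by (simp add: x_def algebra_simps sum.distrib if_distrib[of "\<lambda>z. _ * z"] cong: if_cong)
  have col: "(\<Sum>k\<in>I. cnj (x c k) * f k) = f i + cnj c * f j" for f c
  proof -
    have "(\<Sum>k\<in>I. cnj (x c k) * f k) = cnj (\<Sum>k\<in>I. cnj (f k) * x c k)"
      by (simp add: mult.commute)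
    then show ?thesis unfolding row by simp
  qed
  have Q: "Q (x c) = M i i + c * M i j + cnj c * (M j i + c * M j j)" for c
  proof -
    have "Q (x c) = (\<Sum>k\<in>I. cnj (x c k) * (\<Sum>l\<in>I. M k l * x c l))"
      unfolding Q_def by (simp add: sum_distrib_left mult.assoc)
    then show ?thesis unfolding row col by simp
  qed
  have d: "Im (M k k) = 0" if "k \<in> I" for k
  proof -
    have "Q (\<lambda>l. if l = k then 1 else 0) = M k k"
      unfolding Q_def using that assms(1)
      by (simp add: if_distrib[of cnj] if_distrib[of "\<lambda>z. _ * z"] if_distrib[of "\<lambda>z. z * _"] cong: if_cong)
    then show ?thesis using real by metis
  qed
  have "Im (M i j) + Im (M j i) = 0"
    using real[of "x 1"] d assms(3,4) unfolding Q by simp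
  moreover have "Re (M i j) - Re (M j i) = 0"
    using real[of "x \<i>"] d assms(3,4) unfolding Q by simp
  ultimately show ?thesis by (simp add: complex_eq_iff)
qed

text \<open>Completing the square: if \<open>X a a > 0\<close>, subtracting the rank-one matrix \<open>w w\<^sup>T\<close> with
  \<open>w i = X a i / sqrt (X a a)\<close> clears row and column \<open>a\<close>, and what is left is the minimum
  of the form over the coordinate at \<open>a\<close>, hence still nonnegative. If \<open>X a a = 0\<close>, the form is affine in
  that coordinate, so row \<open>a\<close> vanishes already.\<close>

lemma real_psd_decomposition:
  fixes X :: "'i \<Rightarrow> 'i \<Rightarrow> real"
  assumes "finite S"
    and "\<And>i j. i \<in> S \<Longrightarrow> j \<in> S \<Longrightarrow> X i j = X j i"
    and "\<And>x. (\<Sum>i\<in>S. \<Sum>j\<in>S. X i j * (x i * x j)) \<ge> 0"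
  shows "\<exists>v. \<forall>i\<in>S. \<forall>j\<in>S. X i j = (\<Sum>k\<in>S. v k i * v k j)"
  using assms
proof (induction S arbitrary: X rule: finite_induct)
  case empty
  show ?case by simp
next
  case (insert a S)
  have sym: "X i j = X j i" if "i \<in> insert a S" "j \<in> insert a S" for i j
    using insert.prems(1) that .
  have expand: "(\<Sum>i\<in>insert a S. \<Sum>j\<in>insert a S. X i j * (x i * x j)) =
      X a a * (x a)\<^sup>2 + 2 * x a * (\<Sum>i\<in>S. X a i * x i) + (\<Sum>i\<in>S. \<Sum>j\<in>S. X i j * (x i * x j))" for x
  proof -
    have "(\<Sum>i\<in>S. X i a * (x i * x a)) = x a * (\<Sum>i\<in>S. X a i * x i)"
      unfolding sum_distrib_left by (intro sum.cong refl) (simp add: sym)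
    moreover have "(\<Sum>i\<in>S. X a i * (x a * x i)) = x a * (\<Sum>i\<in>S. X a i * x i)"
      unfolding sum_distrib_left by (intro sum.cong refl) simp
    ultimately show ?thesis
      using insert.hyps by (simp add: sum.distrib power2_eq_square)
  qed
  have psd: "X a a * t\<^sup>2 + 2 * t * (\<Sum>i\<in>S. X a i * x i) + (\<Sum>i\<in>S. \<Sum>j\<in>S. X i j * (x i * x j)) \<ge> 0"
    for t x
  proof -
    let ?x = "x(a := t)"
    have "(\<Sum>i\<in>S. X a i * ?x i) = (\<Sum>i\<in>S. X a i * x i)"
      "(\<Sum>i\<in>S. \<Sum>j\<in>S. X i j * (?x i * ?x j)) = (\<Sum>i\<in>S. \<Sum>j\<in>S. X i j * (x i * x j))"
      using insert.hyps by (auto intro!: sum.cong)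
    then show ?thesis using insert.prems(2)[of ?x] unfolding expand by simp
  qed
  \<comment> \<open>If \<open>X a a = 0\<close>, division by zero makes \<open>w\<close> vanish, which is the vector needed in that case.\<close>
  define w where "w i = X a i / sqrt (X a a)" for i
  have pos: "X a a \<ge> 0"
    using psd[of 1 "\<lambda>_. 0"] by simp
  have row_zero: "X a j = 0" if "X a a = 0" "j \<in> S" for j
  proof (rule ccontr)
    assume "X a j \<noteq> 0"
    let ?x = "\<lambda>i. if i = j then 1 else 0 :: real"
    have "(\<Sum>i\<in>S. X a i * ?x i) = X a j" "(\<Sum>i\<in>S. \<Sum>l\<in>S. X i l * (?x i * ?x l)) = X j j"
      using that insert.hyps by (simp_all add: if_distrib[of "\<lambda>z. _ * z"] cong: if_cong)
    then have "2 * t * X a j + X j j \<ge> 0" for t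
      using psd[of t ?x] that by simp
    from this[of "- (X j j + 1) / (2 * X a j)"] show False
      using \<open>X a j \<noteq> 0\<close> by (simp add: field_simps)
  qed
  have row: "X a i = w a * w i" if "i \<in> insert a S" for i
    using row_zero pos that by (cases "X a a = 0") (auto simp: w_def)
  define Y where "Y i j = X i j - w i * w j" for i j
  have "(\<Sum>i\<in>S. \<Sum>j\<in>S. Y i j * (x i * x j)) \<ge> 0" for x
  proof -
    let ?b = "\<Sum>i\<in>S. w i * x i"
    have b: "(\<Sum>i\<in>S. X a i * x i) = w a * ?b"
      unfolding sum_distrib_left by (intro sum.cong refl) (simp add: row)
    have Y: "(\<Sum>i\<in>S. \<Sum>j\<in>S. Y i j * (x i * x j)) = (\<Sum>i\<in>S. \<Sum>j\<in>S. X i j * (x i * x j)) - ?b\<^sup>2"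
      by (simp add: Y_def power2_eq_square sum_product sum_subtractf algebra_simps)
    show ?thesis
    proof (cases "X a a = 0")
      case True
      then show ?thesis using Y psd[of 0 x] by (simp add: w_def)
    next
      case False
      then have "w a \<noteq> 0" by (simp add: w_def)
      moreover have "X a a = w a * w a" by (rule row) simp
      ultimately show ?thesis
        using psd[of "- ?b / w a" x] unfolding Y b by (simp add: power2_eq_square field_simps)
    qed
  qed
  moreover have "Y i j = Y j i" if "i \<in> S" "j \<in> S" for i j
    using that sym by (simp add: Y_def)
  ultimately obtain v where v: "\<forall>i\<in>S. \<forall>j\<in>S. Y i j = (\<Sum>k\<in>S. v k i * v k j)"
    using insert.IH by blast
  define u where "u k i = (if k = a then w i else if i = a then 0 else v k i)" for k i
  have "X i j = (\<Sum>k\<in>insert a S. u k i * u k j)" if ij: "i \<in> insert a S" "j \<in> insert a S" for i j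
  proof -
    have "(\<Sum>k\<in>S. u k i * u k j) = (if i = a \<or> j = a then 0 else Y i j)"
      using insert.hyps v ij by (auto simp: u_def intro!: sum.neutral sum.cong)
    moreover have "(\<Sum>k\<in>insert a S. u k i * u k j) = w i * w j + (\<Sum>k\<in>S. u k i * u k j)"
      using insert.hyps by (simp add: u_def)
    moreover have "X i j = w i * w j" if "i = a \<or> j = a"
      using that row[OF ij(1)] row[OF ij(2)] sym[OF ij] by (auto simp: mult.commute)
    ultimately show ?thesis by (auto simp: Y_def)
  qed
  then show ?case by blast
qed

section \<open>Choi matrices and duals\<close>

lemma conj_transpose_nth [simp]: "conj_transpose A $ i $ j = cnj (A $ j $ i)"
  by (simp add: conj_transpose_def transpose_def)

text \<open>The Choi matrix is the ampliation of \<open>\<Phi>\<close> applied to \<open>\<Sum>a b. E\<^sub>a\<^sub>b \<otimes> E\<^sub>a\<^sub>b\<close>, the matrix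
  with quadratic form \<open>\<bar>\<Sum>r. x (r, r)\<bar>\<^sup>2\<close>.\<close>

lemma choi_matrix_psd:
  fixes \<Phi> :: "complex^'n^'n \<Rightarrow> complex^'n^'n"
  assumes "completely_positive \<Phi>"
  shows "psd_on UNIV (\<lambda>(i, a) (j, b). \<Phi> (unit_matrix a b) $ i $ j)"
proof -
  let ?k = "CARD('n)"
  \<comment> \<open>The second tensor factor is indexed by numbers; \<open>f\<close> identifies them with the matrix indices.\<close>
  obtain f :: "'n \<Rightarrow> nat" where f: "bij_betw f UNIV {..<?k}"
    using ex_bij_betw_finite_nat[of "UNIV :: 'n set"] by (auto simp: atLeast0LessThan)
  then have inj: "f a = f b \<longleftrightarrow> a = b" for a b
    by (auto simp: bij_betw_def inj_on_def)
  have reindex: "(\<Sum>p\<in>UNIV \<times> {..<?k}. g p) = (\<Sum>(i, a)\<in>UNIV. g (i, f a))"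
    for g :: "'n \<times> nat \<Rightarrow> complex"
  proof -
    have "bij_betw (map_prod id f) (UNIV \<times> UNIV) (UNIV \<times> {..<?k})"
      by (intro bij_betw_map_prod f) simp
    from sum.reindex_bij_betw[OF this, of g] show ?thesis
      by (simp add: case_prod_unfold map_prod_def)
  qed
  define M :: "'n \<times> nat \<Rightarrow> 'n \<times> nat \<Rightarrow> complex"
    where "M = (\<lambda>(r, a) (s, b). if f r = a \<and> f s = b then 1 else 0)"
  have "psd_on (UNIV \<times> {..<?k}) M"
    unfolding psd_on_def
  proof
    fix x :: "'n \<times> nat \<Rightarrow> complex"
    define y where "y = (\<Sum>r\<in>UNIV. x (r, f r))"
    have "(\<Sum>p\<in>UNIV \<times> {..<?k}. \<Sum>q\<in>UNIV \<times> {..<?k}. cnj (x p) * M p q * x q)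
      = (\<Sum>r\<in>UNIV. \<Sum>a\<in>UNIV. \<Sum>s\<in>UNIV. \<Sum>b\<in>UNIV.
           if b = s then (if a = r then cnj (x (r, f a)) * x (s, f b) else 0) else 0)"
      unfolding reindex UNIV_Times_UNIV[symmetric] sum.cartesian_product[symmetric]
      by (intro sum.cong refl) (auto simp: M_def inj)
    also have "\<dots> = (\<Sum>r\<in>UNIV. \<Sum>a\<in>UNIV. if a = r then (\<Sum>s\<in>UNIV. cnj (x (r, f a)) * x (s, f s)) else 0)"
      by (intro sum.cong refl) auto
    also have "\<dots> = cnj y * y"
      by (simp add: y_def sum_product)
    also have "\<dots> \<in> \<real>\<^sub>\<ge>\<^sub>0"
      by (simp add: complex_nonneg_Reals_iff)
    finally show "(\<Sum>p\<in>UNIV \<times> {..<?k}. \<Sum>q\<in>UNIV \<times> {..<?k}. cnj (x p) * M p q * x q) \<in> \<real>\<^sub>\<ge>\<^sub>0" .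
  qed
  then have psd: "psd_on (UNIV \<times> {..<?k}) (ampliation \<Phi> M)"
    using assms unfolding completely_positive_def by blast
  have "(\<chi> r s. M (r, f a) (s, f b)) = unit_matrix a b" for a b
    by (auto simp: M_def inj unit_matrix_def vec_eq_iff)
  then have ampl: "ampliation \<Phi> M (i, f a) (j, f b) = \<Phi> (unit_matrix a b) $ i $ j" for i a j b
    by (simp add: ampliation_def)
  have inv_f: "inv f (f a) = a" for a
    using inj by (simp add: inv_f_f inj_def)
  show ?thesis
    unfolding psd_on_def
  proof
    fix x :: "'n \<times> 'n \<Rightarrow> complex"
    show "(\<Sum>p\<in>UNIV. \<Sum>q\<in>UNIV. cnj (x p) *
        (case p of (i, a) \<Rightarrow> \<lambda>(j, b). \<Phi> (unit_matrix a b) $ i $ j) q * x q) \<in> \<real>\<^sub>\<ge>\<^sub>0"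
      using psd[unfolded psd_on_def, rule_format, of "\<lambda>(i, n). x (i, inv f n)"]
      unfolding reindex by (simp add: case_prod_unfold ampl inv_f)
  qed
qed

definition choi_form :: "(complex^'n^'n \<Rightarrow> complex^'n^'n) \<Rightarrow> complex^'n^'n \<Rightarrow> complex^'n^'n \<Rightarrow> complex"
  where "choi_form \<Phi> V W = (\<Sum>i\<in>UNIV. \<Sum>a\<in>UNIV. \<Sum>j\<in>UNIV. \<Sum>b\<in>UNIV.
    cnj (V $ i $ a) * \<Phi> (unit_matrix a b) $ i $ j * W $ j $ b)"

lemma choi_form_nonneg:
  assumes "completely_positive \<Phi>"
  shows "choi_form \<Phi> V V \<in> \<real>\<^sub>\<ge>\<^sub>0"
  using choi_matrix_psd[OF assms, unfolded psd_on_def, rule_format, of "\<lambda>(i, a). V $ i $ a"]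
  unfolding choi_form_def UNIV_Times_UNIV[symmetric] sum.cartesian_product' by simp

lemma choi_matrix_hermitian:
  assumes "completely_positive \<Phi>"
  shows "\<Phi> (unit_matrix b a) $ j $ i = cnj (\<Phi> (unit_matrix a b) $ i $ j)"
  using psd_on_hermitian[OF finite_class.finite_UNIV choi_matrix_psd[OF assms], of "(i, a)" "(j, b)"]
  by simp

lemma self_dual_iff:
  assumes "clinear \<Phi>"
  shows "self_dual \<Phi> \<longleftrightarrow> (\<forall>A B. hs_inner A (\<Phi> B) = hs_inner (\<Phi> A) B)"
proof
  assume "self_dual \<Phi>"
  then show "\<forall>A B. hs_inner A (\<Phi> B) = hs_inner (\<Phi> A) B"
    using is_dual_map_dual_map[OF assms] unfolding self_dual_def is_dual_map_def by metis
next
  assume "\<forall>A B. hs_inner A (\<Phi> B) = hs_inner (\<Phi> A) B"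
  then have "is_dual_map \<Phi> \<Phi>" using assms by (simp add: is_dual_map_def)
  then show "self_dual \<Phi>"
    unfolding self_dual_def by (rule is_dual_map_unique) (rule is_dual_map_dual_map[OF assms])
qed

lemma hs_inner_commute: "hs_inner B A = cnj (hs_inner A B)"
  by (simp add: hs_inner_sum mult.commute)

text \<open>Cyclicity of the trace.\<close>

lemma hs_inner_hermitian_conjugation:
  assumes "hermitian R"
  shows "hs_inner A (R ** B ** R) = hs_inner (R ** A ** R) B"
proof -
  have R: "conj_transpose R = R" using assms by (simp add: hermitian_def)
  have mult: "conj_transpose (X ** Y) = conj_transpose Y ** conj_transpose X" for X Y :: "complex^'n^'n"
    by (simp add: vec_eq_iff matrix_matrix_mult_def mult.commute)
  have "hs_inner A (R ** B ** R) = trace ((A ** R ** conj_transpose B) ** R)"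
    by (simp add: hs_inner_def mult R matrix_mul_assoc)
  also have "\<dots> = trace (R ** (A ** R ** conj_transpose B))" by (rule trace_mul_sym)
  also have "\<dots> = hs_inner (R ** A ** R) B" by (simp add: hs_inner_def matrix_mul_assoc)
  finally show ?thesis .
qed

lemma self_dual_hermitian_mixture:
  assumes "clinear \<Phi>" and "\<And>A. \<Phi> A = (\<Sum>i\<in>S. p i *\<^sub>R (R i ** A ** R i))"
    and "\<And>i. i \<in> S \<Longrightarrow> hermitian (R i)"
  shows "self_dual \<Phi>"
  unfolding self_dual_iff[OF assms(1)]
proof (intro allI)
  fix A B
  have scaleR: "p *\<^sub>R X = cscale (of_real p) X" for p and X :: "complex^'n^'n"
    by (simp add: cscale_def vec_eq_iff scaleR_conv_of_real[where 'a = complex])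
  have right: "hs_inner C (\<Phi> D) = (\<Sum>i\<in>S. of_real (p i) * hs_inner C (R i ** D ** R i))" for C D
    unfolding assms(2) hs_inner_sum_right scaleR hs_inner_cscale_right by simp
  have "hs_inner (\<Phi> A) B = (\<Sum>i\<in>S. of_real (p i) * hs_inner (R i ** A ** R i) B)"
    unfolding hs_inner_commute[of "\<Phi> A"] right by (simp add: hs_inner_commute[symmetric])
  also have "\<dots> = hs_inner A (\<Phi> B)"
    unfolding right by (intro sum.cong refl) (simp add: hs_inner_hermitian_conjugation assms(3))
  finally show "hs_inner A (\<Phi> B) = hs_inner (\<Phi> A) B" by simp
qed

section \<open>Pauli matrices\<close>

definition pauli :: "3 \<Rightarrow> complex^2^2" where
  "pauli k = (if k = 1 then vector [vector [0, 1], vector [1, 0]]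
     else if k = 2 then vector [vector [0, - \<i>], vector [\<i>, 0]]
     else vector [vector [1, 0], vector [0, - 1]])"

definition pauli_vector :: "real^3 \<Rightarrow> complex^2^2" where
  "pauli_vector v = (\<Sum>k\<in>UNIV. v $ k *\<^sub>R pauli k)"

lemma pauli_nth [simp]:
  "pauli 1 $ 1 $ 1 = 0" "pauli 1 $ 1 $ 2 = 1" "pauli 1 $ 2 $ 1 = 1" "pauli 1 $ 2 $ 2 = 0"
  "pauli 2 $ 1 $ 1 = 0" "pauli 2 $ 1 $ 2 = - \<i>" "pauli 2 $ 2 $ 1 = \<i>" "pauli 2 $ 2 $ 2 = 0"
  "pauli 3 $ 1 $ 1 = 1" "pauli 3 $ 1 $ 2 = 0" "pauli 3 $ 2 $ 1 = 0" "pauli 3 $ 2 $ 2 = - 1"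
  by (simp_all add: pauli_def)

lemma hermitian_pauli_vector: "hermitian (pauli_vector v)"
  by (simp add: hermitian_def pauli_vector_def vec_eq_iff forall_2 sum_3)

text \<open>Distinct Pauli matrices anticommute, so the mixed terms of the square cancel.\<close>

lemma pauli_vector_square: "pauli_vector v ** pauli_vector v = (norm v)\<^sup>2 *\<^sub>R mat 1"
  by (simp add: norm_eq_square dot_square_norm[symmetric] inner_vec_def pauli_vector_def vec_eq_iff forall_2
    matrix_matrix_mult_def sum_2 sum_3 mat_def complex_eq_iff algebra_simps)

lemma pauli_vector_scaleR: "pauli_vector (c *\<^sub>R v) = c *\<^sub>R pauli_vector v"
  by (simp add: pauli_vector_def scaleR_sum_right)

lemma unitary_pauli_vector:
  assumes "norm v = 1"
  shows "unitary (pauli_vector v)"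
  using hermitian_pauli_vector[of v] pauli_vector_square[of v] assms
  by (simp add: hermitian_def unitary_def)

lemma pauli_vector_conjugation:
  "pauli_vector v ** A ** pauli_vector v =
     (\<Sum>i\<in>UNIV. \<Sum>j\<in>UNIV. (v $ i * v $ j) *\<^sub>R (pauli i ** A ** pauli j))"
  by (simp add: pauli_vector_def vec_eq_iff forall_2 matrix_matrix_mult_def sum_2 sum_3
    scaleR_conv_of_real[where 'a = complex] algebra_simps)

section \<open>Self-dual doubly stochastic maps on \<open>2 \<times> 2\<close> matrices\<close>

text \<open>The symmetries of the Choi matrix leave two real parameters \<open>s\<close>, \<open>t\<close> and two complex
  ones \<open>w\<close>, \<open>u\<close>: as many real ones as a symmetric \<open>3 \<times> 3\<close> matrix has. All later identities are read off from
  the resulting table of entries, with \<open>X\<close> the block of \<open>\<chi>\<close> on the Pauli matrices and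
  \<open>p0\<close> its entry at the identity.\<close>

lemma self_dual_pauli_decomposition:
  fixes \<Phi> :: "complex^2^2 \<Rightarrow> complex^2^2"
  assumes "doubly_stochastic \<Phi>" "self_dual \<Phi>"
  obtains p0 :: real and v :: "3 \<Rightarrow> real^3" where "p0 \<ge> 0"
    "\<And>A. \<Phi> A = p0 *\<^sub>R A + (\<Sum>k\<in>UNIV. pauli_vector (v k) ** A ** pauli_vector (v k))"
proof -
  have cp: "completely_positive \<Phi>" and unital: "\<Phi> (mat 1) = mat 1"
    using assms(1) by (auto simp: doubly_stochastic_def)
  then have lin: "clinear \<Phi>" by (simp add: completely_positive_def)
  define c where "c i j a b = \<Phi> (unit_matrix a b) $ i $ j" for i j a b
  have herm: "c j i b a = cnj (c i j a b)" for i j a b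
    unfolding c_def by (rule choi_matrix_hermitian[OF cp])
  have "hs_inner A (\<Phi> B) = hs_inner (\<Phi> A) B" for A B
    using self_dual_iff[OF lin] assms(2) by blast
  then have dual: "c a b i j = cnj (c i j a b)" for i j a b
    unfolding c_def by (metis hs_inner_commute hs_inner_unit_matrix)
  have \<Phi>: "\<Phi> A $ i $ j = (\<Sum>a\<in>UNIV. \<Sum>b\<in>UNIV. A $ a $ b * c i j a b)" for A i j
    by (subst clinear_expansion[OF lin]) (simp add: c_def cscale_def)
  have unital': "c i j 1 1 + c i j 2 2 = (if i = j then 1 else 0)" for i j
    using \<Phi>[of "mat 1" i j] unfolding unital by (simp add: sum_2 mat_def)
  \<comment> \<open>Every entry of the Choi matrix in terms of the four parameters.\<close>
  define s t w u where "s = Re (c 1 1 1 1)" and "t = Re (c 1 2 1 2)"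
    and "w = c 1 2 1 1" and "u = c 1 2 2 1"
  have 1: "c 1 1 1 1 = s" "c 1 2 1 2 = t" "c 1 2 1 1 = w" "c 1 2 2 1 = u"
    using herm[of 1 1 1 1] dual[of 1 2 1 2] by (auto simp: s_def t_def w_def u_def complex_eq_iff)
  have 2: "c 2 1 1 1 = cnj w" "c 1 1 1 2 = cnj w" "c 1 1 2 1 = w" "c 2 1 1 2 = cnj u" "c 2 1 2 1 = cnj t"
    using herm[of 1 2 1 1] dual[of 1 2 1 1] herm[of 1 1 1 2] herm[of 1 2 2 1] herm[of 1 2 1 2] 1 by auto
  have 3: "c 1 1 2 2 = 1 - s" "c 1 2 2 2 = - w" "c 2 1 2 2 = - cnj w"
    using unital'[of 1 1] unital'[of 1 2] unital'[of 2 1] 1 2 by (auto simp: algebra_simps eq_neg_iff_add_eq_0)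
  have 4: "c 2 2 1 1 = 1 - s" "c 2 2 1 2 = - cnj w" "c 2 2 2 1 = - w"
    by (subst dual, simp add: 3)+
  have 5: "c 2 2 2 2 = s"
    using unital'[of 2 2] 4 by (auto simp: algebra_simps)
  note c = 1 2 3 4 5
  define X where "X i j = Re (choi_form \<Phi> (pauli i) (pauli j)) / 4" for i j
  have X: "X 1 1 = (1 - s + Re u) / 2" "X 2 2 = (1 - s - Re u) / 2" "X 3 3 = (s - t) / 2"
    "X 1 2 = - Im u / 2" "X 1 3 = Re w" "X 2 3 = - Im w"
    "X 2 1 = - Im u / 2" "X 3 1 = Re w" "X 3 2 = - Im w"
    by (simp_all add: X_def choi_form_def c_def[symmetric] sum_2 c)
  have "X i j = X j i" for i j
    using exhaust_3[of i] exhaust_3[of j] by (auto simp: X)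
  moreover have "(\<Sum>i\<in>UNIV. \<Sum>j\<in>UNIV. X i j * (x i * x j)) \<ge> 0" for x
  proof -
    let ?V = "pauli_vector (\<chi> k. x k)"
    \<comment> \<open>Up to the factor 4, \<open>X\<close> is the real part of the Gram matrix of the Choi form on the Pauli matrices.\<close>
    have "(\<Sum>i\<in>UNIV. \<Sum>j\<in>UNIV. X i j * (x i * x j)) = Re (choi_form \<Phi> ?V ?V) / 4"
      by (simp add: X choi_form_def c_def[symmetric] sum_2 sum_3 c pauli_vector_def algebra_simps
        add_divide_distrib diff_divide_distrib)
    also have "\<dots> \<ge> 0"
      using choi_form_nonneg[OF cp, of ?V] by (simp add: complex_nonneg_Reals_iff)
    finally show ?thesis .
  qed
  ultimately have "\<exists>v. \<forall>i\<in>UNIV. \<forall>j\<in>UNIV. X i j = (\<Sum>k\<in>(UNIV :: 3 set). v k i * v k j)"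
    by (intro real_psd_decomposition) auto
  then obtain v where v: "X i j = (\<Sum>k\<in>(UNIV :: 3 set). v k i * v k j)" for i j
    by (elim exE) simp
  define p0 where "p0 = Re (choi_form \<Phi> (mat 1) (mat 1)) / 4"
  have p0: "p0 = (s + t) / 2"
    by (simp add: p0_def choi_form_def c_def[symmetric] sum_2 c mat_def)
  show ?thesis
  proof
    show "p0 \<ge> 0"
      using choi_form_nonneg[OF cp, of "mat 1"] by (simp add: p0_def complex_nonneg_Reals_iff)
    fix A
    \<comment> \<open>Conjugation by \<open>v \<cdot> \<sigma>\<close> is quadratic in \<open>v\<close>, so only the sum of the \<open>v\<^sub>k v\<^sub>k\<^sup>T\<close> matters.\<close>
    have "(\<Sum>k\<in>UNIV. pauli_vector (\<chi> i. v k i) ** A ** pauli_vector (\<chi> i. v k i)) =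
        (\<Sum>i\<in>UNIV. \<Sum>j\<in>UNIV. X i j *\<^sub>R (pauli i ** A ** pauli j))"
      unfolding pauli_vector_conjugation v scaleR_sum_left
      by (simp add: sum_3 add_ac)
    moreover have "\<Phi> A = p0 *\<^sub>R A + (\<Sum>i\<in>UNIV. \<Sum>j\<in>UNIV. X i j *\<^sub>R (pauli i ** A ** pauli j))"
      by (simp add: vec_eq_iff forall_2 \<Phi> sum_2 sum_3 c X p0 matrix_matrix_mult_def complex_eq_iff field_simps)
    ultimately show "\<Phi> A = p0 *\<^sub>R A +
        (\<Sum>k\<in>UNIV. pauli_vector (\<chi> i. v k i) ** A ** pauli_vector (\<chi> i. v k i))" by simp
  qed
qed

lemma positive_weights_reindex:
  fixes p :: "'i \<Rightarrow> real" and f :: "'b \<Rightarrow> 'i \<Rightarrow> 'c::real_vector"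
  assumes "finite S" "\<And>i. i \<in> S \<Longrightarrow> p i \<ge> 0"
  shows "\<exists>(m::nat) g. (\<forall>i\<in>{1..m}. g i \<in> S \<and> p (g i) > 0) \<and> (\<Sum>i=1..m. p (g i)) = sum p S \<and>
    (\<forall>A. (\<Sum>i=1..m. p (g i) *\<^sub>R f A (g i)) = (\<Sum>i\<in>S. p i *\<^sub>R f A i))"
proof -
  define T where "T = {i \<in> S. p i > 0}"
  have T: "finite T" "T \<subseteq> S" using assms by (auto simp: T_def)
  then obtain g where g: "bij_betw g {1..card T} T"
    using ex_bij_betw_nat_finite_1 by blast
  have zero: "p i = 0" if "i \<in> S - T" for i
    using that assms(2)[of i] by (auto simp: T_def)
  show ?thesis
  proof (intro exI[of _ "card T"] exI[of _ g] conjI ballI allI)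
    show "g i \<in> S" "p (g i) > 0" if "i \<in> {1..card T}" for i
      using bij_betwE[OF g] that by (auto simp: T_def)
    show "(\<Sum>i=1..card T. p (g i)) = sum p S"
      unfolding sum.reindex_bij_betw[OF g] using assms(1) T zero by (intro sum.mono_neutral_left) auto
    show "(\<Sum>i=1..card T. p (g i) *\<^sub>R f A (g i)) = (\<Sum>i\<in>S. p i *\<^sub>R f A i)" for A
      unfolding sum.reindex_bij_betw[OF g, of "\<lambda>i. p i *\<^sub>R f A i"]
      using assms(1) T zero by (intro sum.mono_neutral_left) auto
  qed
qed

theorem theorem9:
  fixes \<Phi> :: "complex^2^2 \<Rightarrow> complex^2^2"
  assumes "doubly_stochastic \<Phi>"
  shows "self_dual \<Phi> \<longleftrightarrow>
    (\<exists>(m::nat) (p::nat \<Rightarrow> real) (R::nat \<Rightarrow> complex^2^2).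
       (\<forall>i\<in>{1..m}. unitary (R i) \<and> hermitian (R i) \<and> p i > 0) \<and>
       (\<Sum>i=1..m. p i) = 1 \<and>
       (\<forall>A. \<Phi> A = (\<Sum>i=1..m. p i *\<^sub>R (R i ** A ** R i))))" (is "_ \<longleftrightarrow> ?mixture")
proof
  assume "self_dual \<Phi>"
  then obtain p0 :: real and v :: "3 \<Rightarrow> real^3" where "p0 \<ge> 0" and
    \<Phi>: "\<And>A. \<Phi> A = p0 *\<^sub>R A + (\<Sum>k\<in>UNIV. pauli_vector (v k) ** A ** pauli_vector (v k))"
    using self_dual_pauli_decomposition[OF assms] by blast
  \<comment> \<open>The index \<open>None\<close> carries the identity term. For \<open>v k = 0\<close> the weight is zero, and the identity
    stands in for the undefined direction of \<open>v k\<close>.\<close>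
  define p where "p = case_option p0 (\<lambda>k. (norm (v k))\<^sup>2)"
  define R where "R = case_option (mat 1)
    (\<lambda>k. if v k = 0 then mat 1 else pauli_vector (v k /\<^sub>R norm (v k)))"
  have reflection: "unitary (R i) \<and> hermitian (R i)" for i
  proof -
    have "unitary (mat 1 :: complex^2^2)" "hermitian (mat 1 :: complex^2^2)"
      by (simp_all add: unitary_def hermitian_def vec_eq_iff forall_2 matrix_matrix_mult_def sum_2 mat_def)
    then show ?thesis
      by (auto simp: R_def hermitian_pauli_vector unitary_pauli_vector split: option.split)
  qed
  have sum_option: "(\<Sum>i\<in>UNIV. g i) = g None + (\<Sum>k\<in>UNIV. g (Some k))"
    for g :: "3 option \<Rightarrow> 'b::comm_monoid_add"
    by (simp add: UNIV_option_conv sum.reindex)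
  have summand: "p (Some k) *\<^sub>R (R (Some k) ** A ** R (Some k)) = pauli_vector (v k) ** A ** pauli_vector (v k)"
    for k A
  proof (cases "v k = 0")
    case True
    then show ?thesis by (simp add: p_def pauli_vector_def)
  next
    case False
    then have "pauli_vector (v k) = norm (v k) *\<^sub>R R (Some k)"
      by (simp add: R_def pauli_vector_scaleR[symmetric])
    then show ?thesis
      by (simp add: p_def power2_eq_square matrix_scalar_ac scalar_matrix_assoc[symmetric])
  qed
  have mixture: "\<Phi> A = (\<Sum>i\<in>UNIV. p i *\<^sub>R (R i ** A ** R i))" for A
    unfolding \<Phi> sum_option summand by (simp add: p_def R_def)
  \<comment> \<open>Evaluating \<open>\<Phi>\<close> at the identity yields the total weight.\<close>
  have "R i ** R i = mat 1" for i
    using reflection unfolding unitary_def hermitian_def by metis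
  then have "(mat 1 :: complex^2^2) = (\<Sum>i\<in>UNIV. p i *\<^sub>R mat 1)"
    using mixture[of "mat 1"] assms by (simp add: doubly_stochastic_def)
  also have "\<dots> = sum p UNIV *\<^sub>R mat 1" by (simp add: scaleR_sum_left)
  finally have total: "sum p UNIV = 1"
    by (simp add: vec_eq_iff forall_2 mat_def complex_eq_iff)
  have "p i \<ge> 0" for i
    using \<open>p0 \<ge> 0\<close> by (simp add: p_def split: option.split)
  then have "\<exists>(m::nat) g. (\<forall>i\<in>{1..m}. g i \<in> UNIV \<and> p (g i) > 0) \<and> (\<Sum>i=1..m. p (g i)) = sum p UNIV \<and>
    (\<forall>A. (\<Sum>i=1..m. p (g i) *\<^sub>R (R (g i) ** A ** R (g i))) = (\<Sum>i\<in>UNIV. p i *\<^sub>R (R i ** A ** R i)))"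
    by (intro positive_weights_reindex[where f = "\<lambda>A i. R i ** A ** R i"]) auto
  then obtain m :: nat and g where "\<forall>i\<in>{1..m}. p (g i) > 0" "(\<Sum>i=1..m. p (g i)) = sum p UNIV"
    "\<forall>A. (\<Sum>i=1..m. p (g i) *\<^sub>R (R (g i) ** A ** R (g i))) = (\<Sum>i\<in>UNIV. p i *\<^sub>R (R i ** A ** R i))"
    by (elim exE conjE) simp
  then show ?mixture
    using reflection total mixture by (intro exI[of _ m] exI[of _ "p \<circ> g"] exI[of _ "R \<circ> g"]) simp
next
  assume ?mixture
  then show "self_dual \<Phi>"
    using assms by (auto simp: doubly_stochastic_def completely_positive_def intro: self_dual_hermitian_mixture)
qed

end
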